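(* For every positive integer $d$ and all positive real numbers $\varepsilon$ and $\delta$ with $\varepsilon<1/2$, there is a positive $K=K(d,\varepsilon,\delta)$ such that the following holds. Let $Y=(Y_1,\dots,Y_N)$ be a sequence of $N$ independent $\mathrm{Ber}(p)$ random variables for some $p\in(0,1-\varepsilon]$ and let $X=X(Y)$ be a nonzero polynomial with nonnegative coefficients and degree at most $d$ such that $\Phi_X(\delta-\varepsilon)\ge K\log(1/p)$. Denote by $\mathcal{I}^*$ the collection of all subsets $I\subseteq[N]$ satisfying (C1) $\mathbb{E}_I[X]\ge(1+\delta-\varepsilon)\mathbb{E}[X]$, (C2) $|I|\le K\cdot\Phi_X(\delta+\varepsilon)$, and (C3) $\min_{i\in I}\big(\mathbb{E}_I[X]-\mathbb{E}_{I\setminus\{i\}}[X]\big)\ge \mathbb{E}[X]/\big(K\cdot\Phi_X(\delta+\varepsilon)\big)$, and assume that $\mathcal{I}^*$ is an entropically stable family (with respect to $\varepsilon$ and $p$), that is, for every integer $m$, $$\big|\{I\in\mathcal{I}^*:|I|=m\}\big|\le(1/p)^{\varepsilon m/2}.$$ Then $$(1-\varepsilon)\Phi_X(\delta-\varepsilon)\le-\log\mathbb{P}\big(X\ge(1+\delta)\mathbb{E}[X]\big)\le(1+\varepsilon)\Phi_X(\delta+\varepsilon)$$ and, writing $\mathcal{J}^*$ for the collection of those $I\in\mathcal{I}^*$ with $-\log\mathbb{P}(Y_I=1)\le(1+\varepsilon)\Phi_X(\delta+\varepsilon)$, $$\mathbb{P}\big(X\ge(1+\delta)\mathbb{E}[X]\text{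 and }Y_I=0\text{ for all }I\in\mathcal{J}^*\big)\le\varepsilon\,\mathbb{P}\big(X\ge(1+\delta)\mathbb{E}[X]\big).$$
   Context: $[N]=\{1,\dots,N\}$. For $I\subseteq[N]$, $Y_I=\prod_{i\in I}Y_i$ and $\mathbb{E}_I[X]=\mathbb{E}[X\mid Y_I=1]$. A function $X:\{0,1\}^N\to\mathbb{R}_{\ge0}$ is a polynomial with nonnegative coefficients and degree at most $d$ if it can be written as $X=\sum_{I\subseteq[N]}\alpha_IY_I$ with all $\alpha_I\ge0$ and $\alpha_I=0$ whenever $|I|>d$. The function $\Phi_X:\mathbb{R}\to\mathbb{R}_{\ge0}\cup\{\infty\}$ is $$\Phi_X(\delta)=\min\big\{-\log\mathbb{P}(Y_I=1): I\subseteq[N]\text{ and }\mathbb{E}_I[X]\ge(1+\delta)\mathbb{E}[X]\big\},$$ with $\min\emptyset=\infty$. Conventions: $-\log 0=\infty$ and $1/\infty=0$. Logarithms are natural. *)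

theory Defs
  imports "HOL-Probability.Probability"
begin

text \<open>
  Points of \<open>{0,1}\<^sup>N\<close> are represented by functions \<^typ>\<open>nat \<Rightarrow> bool\<close>, of which only the coordinates
  in \<open>{1..N}\<close> matter. Every quantity depends only on the joint law of \<open>Y = (Y\<^sub>1, \<dots>, Y\<^sub>N)\<close>, so
  \<open>Y\<close> is taken to be the identity on the canonical product space (all coordinates outside
  \<open>{1..N}\<close> are fixed to be \<^const>\<open>False\<close>). Working with one concrete sample space also makes it
  unambiguous that the constant \<open>K\<close> cannot depend on the space.
\<close>

definition bernoulli_seq :: "nat \<Rightarrow> real \<Rightarrow> (nat \<Rightarrow> bool) pmf" where
  "bernoulli_seq N p = Pi_pmf {1..N} False (\<lambda>_. bernoulli_pmf p)"

definition Y_prod :: "nat set \<Rightarrow> (nat \<Rightarrow> bool) \<Rightarrow> real" where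
  "Y_prod I y = (\<Prod>i\<in>I. of_bool (y i))"

abbreviation prob_Y :: "nat \<Rightarrow> real \<Rightarrow> (nat \<Rightarrow> bool) set \<Rightarrow> real" where
  "prob_Y N p A \<equiv> measure_pmf.prob (bernoulli_seq N p) A"

abbreviation expect_Y :: "nat \<Rightarrow> real \<Rightarrow> ((nat \<Rightarrow> bool) \<Rightarrow> real) \<Rightarrow> real" where
  "expect_Y N p X \<equiv> measure_pmf.expectation (bernoulli_seq N p) X"

text \<open>
  The conditioning event has positive probability whenever \<open>0 < p \<le> 1\<close> and \<open>I \<subseteq> {1..N}\<close>,
  so that \<^const>\<open>cond_pmf\<close> is meaningful.
\<close>

definition cond_expect_Y ::
    "nat \<Rightarrow> real \<Rightarrow> nat set \<Rightarrow> ((nat \<Rightarrow> bool) \<Rightarrow> real) \<Rightarrow> real" where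
  "cond_expect_Y N p I X =
     measure_pmf.expectation (cond_pmf (bernoulli_seq N p) {y. Y_prod I y = 1}) X"

definition nonneg_poly :: "nat \<Rightarrow> nat \<Rightarrow> ((nat \<Rightarrow> bool) \<Rightarrow> real) \<Rightarrow> bool" where
  "nonneg_poly N d X \<longleftrightarrow>
     (\<exists>\<alpha> :: nat set \<Rightarrow> real.
        (\<forall>I\<subseteq>{1..N}. \<alpha> I \<ge> 0) \<and>
        (\<forall>I\<subseteq>{1..N}. card I > d \<longrightarrow> \<alpha> I = 0) \<and>
        (\<forall>y. X y = (\<Sum>I\<in>Pow {1..N}. \<alpha> I * Y_prod I y)))"

text \<open>The function \<open>x \<mapsto> - log x\<close> with the convention \<open>- log 0 = \<infinity>\<close>.\<close>

definition neg_log :: "real \<Rightarrow> ereal" where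
  "neg_log x = (if x = 0 then \<infinity> else ereal (- ln x))"

text \<open>
  The infimum is over a finite set, hence it is a minimum, except that the infimum of the
  empty set is \<open>\<infinity>\<close>, as required.
\<close>

definition Phi :: "nat \<Rightarrow> real \<Rightarrow> ((nat \<Rightarrow> bool) \<Rightarrow> real) \<Rightarrow> real \<Rightarrow> ereal" where
  "Phi N p X \<delta> =
     Inf {neg_log (prob_Y N p {y. Y_prod I y = 1}) | I.
            I \<subseteq> {1..N} \<and> cond_expect_Y N p I X \<ge> (1 + \<delta>) * expect_Y N p X}"

text \<open>
  In the third condition, division by \<open>\<infinity>\<close> in \<^typ>\<open>ereal\<close> yields \<open>0\<close>, in accordance with
  the convention \<open>1 / \<infinity> = 0\<close>.
\<close>

definition core_family ::
    "nat \<Rightarrow> real \<Rightarrow> ((nat \<Rightarrow> bool) \<Rightarrow> real) \<Rightarrow> real \<Rightarrow> real \<Rightarrow> real \<Rightarrow> nat set set" where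
  "core_family N p X \<epsilon> \<delta> K =
     {I. I \<subseteq> {1..N} \<and>
         cond_expect_Y N p I X \<ge> (1 + \<delta> - \<epsilon>) * expect_Y N p X \<and>
         ereal (real (card I)) \<le> ereal K * Phi N p X (\<delta> + \<epsilon>) \<and>
         (\<forall>i\<in>I. ereal (cond_expect_Y N p I X - cond_expect_Y N p (I - {i}) X)
                  \<ge> ereal (expect_Y N p X) / (ereal K * Phi N p X (\<delta> + \<epsilon>)))}"

definition small_core_family ::
    "nat \<Rightarrow> real \<Rightarrow> ((nat \<Rightarrow> bool) \<Rightarrow> real) \<Rightarrow> real \<Rightarrow> real \<Rightarrow> real \<Rightarrow> nat set set" where
  "small_core_family N p X \<epsilon> \<delta> K =
     {I \<in> core_family N p X \<epsilon> \<delta> K.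
        neg_log (prob_Y N p {y. Y_prod I y = 1}) \<le> ereal (1 + \<epsilon>) * Phi N p X (\<delta> + \<epsilon>)}"

definition entropically_stable :: "real \<Rightarrow> real \<Rightarrow> nat set set \<Rightarrow> bool" where
  "entropically_stable \<epsilon> p F \<longleftrightarrow>
     (\<forall>m::int. real (card {I \<in> F. int (card I) = m}) \<le> (1 / p) powr (\<epsilon> * real_of_int m / 2))"

end

theory Submission
  imports Defs
begin

text \<open>
  Write \<open>F S\<close> for the conditional expectation of \<open>X\<close> given \<open>Y_prod S = 1\<close>.

  Lower bound on the tail: if \<open>I\<close> attains the minimum in \<open>\<Phi>(\<delta> + \<epsilon>)\<close>, then every smaller set has
  small \<open>F\<close>, and this forces \<open>F (I \<union> J)\<close> to be of order \<open>E X\<close> for all \<open>J\<close> of size at most \<open>d\<close>.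
  Hence the second moment of \<open>X\<close> given \<open>Y_prod I = 1\<close> is of order \<open>(E X)\<^sup>2\<close>, and a Paley--Zygmund
  argument shows that the tail has probability at least a constant times \<open>P(Y_prod I = 1)\<close>.

  Upper bound: on the event that no core (member of \<open>core_family\<close>) appears, a set \<open>S\<close> of size \<open>O(\<Phi>(\<delta> + \<epsilon>))\<close> with
  \<open>Y_prod S = 1\<close> satisfies \<open>F S \<le> (1 + \<delta> - \<epsilon> / 2) E X\<close>, since otherwise deleting its
  inessential elements would leave a core. So the truncated \<open>k\<close>-th moment of \<open>X\<close> is at most
  \<open>((1 + \<delta> - \<epsilon> / 2) E X)\<^sup>k\<close>, and Markov's inequality with \<open>k\<close> of order \<open>\<Phi>(\<delta> + \<epsilon>)\<close> makes the
  coreless tail negligible. By entropic stability, the union bound over cores costs only a constant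
  factor and a factor \<open>1 - \<epsilon> / 2\<close> in the exponent.
\<close>

section \<open>Monomials and expectations under the Bernoulli product measure\<close>

lemma Y_prod_eq_indicator:
  "finite I \<Longrightarrow> Y_prod I y = of_bool (\<forall>i\<in>I. y i)"
  unfolding Y_prod_def by (induction I rule: finite_induct) auto

lemma Y_prod_nonneg: "Y_prod I y \<ge> 0"
  unfolding Y_prod_def by (intro prod_nonneg) auto

lemma Y_prod_le_1: "Y_prod I y \<le> 1"
  unfolding Y_prod_def by (intro prod_le_1) auto

lemma Y_prod_Un:
  "finite I \<Longrightarrow> finite J \<Longrightarrow> Y_prod (I \<union> J) y = Y_prod I y * Y_prod J y"
  by (auto simp: Y_prod_eq_indicator)

lemma integrable_bernoulli_seq [simp]:
  "integrable (measure_pmf (bernoulli_seq N p)) (f :: _ \<Rightarrow> real)"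
proof (rule integrable_measure_pmf_finite)
  show "finite (set_pmf (bernoulli_seq N p))"
    unfolding bernoulli_seq_def by (subst set_Pi_pmf) (auto intro!: finite_PiE_dflt)
qed

lemma expect_Y_mono: "(\<And>y. f y \<le> g y) \<Longrightarrow> expect_Y N p f \<le> expect_Y N p g"
  by (rule integral_mono) auto

lemma expect_Y_prod:
  assumes "0 \<le> p" "p \<le> 1" "I \<subseteq> {1..N}"
  shows "expect_Y N p (Y_prod I) = p ^ card I"
proof -
  \<comment> \<open>Indices outside \<open>I\<close> get the factor 1, so that the product runs over
    all of \<open>{1..N}\<close> and independence applies.\<close>
  let ?f = "\<lambda>i b. if i \<in> I then of_bool b else 1 :: real"
  have "Y_prod I = (\<lambda>y. \<Prod>i\<in>{1..N}. ?f i (y i))"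
    unfolding Y_prod_def using assms(3)
    by (simp add: prod.If_cases Int_absorb1 fun_eq_iff)
  then have "expect_Y N p (Y_prod I) =
      (\<Prod>i\<in>{1..N}. measure_pmf.expectation (bernoulli_pmf p) (?f i))"
    unfolding bernoulli_seq_def
    by (simp only:, intro expectation_prod_Pi_pmf) (auto intro!: integrable_measure_pmf_finite)
  also have "\<dots> = (\<Prod>i\<in>{1..N}. if i \<in> I then p else 1)"
    using assms by (intro prod.cong) auto
  also have "\<dots> = p ^ card I"
    using assms(3) by (simp add: prod.If_cases Int_absorb1)
  finally show ?thesis .
qed

lemma prob_Y_eq_expect: "prob_Y N p A = expect_Y N p (indicat_real A)"
  by simp

lemma indicator_Y_prod:
  "finite I \<Longrightarrow> indicat_real {y. Y_prod I y = 1} = Y_prod I"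
  by (auto simp: fun_eq_iff indicator_def Y_prod_eq_indicator)

lemma prob_Y_prod:
  assumes "0 \<le> p" "p \<le> 1" "I \<subseteq> {1..N}"
  shows "prob_Y N p {y. Y_prod I y = 1} = p ^ card I"
  unfolding prob_Y_eq_expect
  using assms expect_Y_prod indicator_Y_prod[OF finite_subset[OF assms(3)]] by simp

lemma cond_expect_Y_eq:
  assumes "0 < p" "p \<le> 1" "I \<subseteq> {1..N}"
  shows "cond_expect_Y N p I X = expect_Y N p (\<lambda>y. Y_prod I y * X y) / p ^ card I"
proof -
  let ?M = "bernoulli_seq N p" and ?A = "{y. Y_prod I y = 1}"
  have fin: "finite I" using assms(3) finite_subset by blast
  have fM: "finite (set_pmf ?M)"
    unfolding bernoulli_seq_def by (subst set_Pi_pmf) (auto intro!: finite_PiE_dflt)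
  have prob: "measure_pmf.prob ?M ?A = p ^ card I"
    using assms by (intro prob_Y_prod) auto
  \<comment> \<open>\<open>cond_pmf\<close> is only meaningful if the event meets the support;
    positivity of \<open>p ^ card I\<close> guarantees this.\<close>
  have ne: "set_pmf ?M \<inter> ?A \<noteq> {}"
  proof
    assume "set_pmf ?M \<inter> ?A = {}"
    then have "measure_pmf.prob ?M ?A = 0"
      by (simp add: measure_pmf_zero_iff)
    then show False using prob assms by simp
  qed
  have "cond_expect_Y N p I X =
      (\<Sum>y\<in>set_pmf ?M. X y * pmf (cond_pmf ?M ?A) y)"
    unfolding cond_expect_Y_def
    by (intro integral_measure_pmf_real fM) (simp add: set_cond_pmf[OF ne])
  also have "\<dots> = (\<Sum>y\<in>set_pmf ?M. (Y_prod I y * X y) * pmf ?M y / p ^ card I)"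
    by (intro sum.cong refl)
       (subst pmf_cond[OF ne], subst prob, simp add: Y_prod_eq_indicator[OF fin])
  also have "\<dots> = expect_Y N p (\<lambda>y. Y_prod I y * X y) / p ^ card I"
    using integral_measure_pmf_real[OF fM, of ?M "\<lambda>y. Y_prod I y * X y"]
    by (simp add: sum_divide_distrib)
  finally show ?thesis .
qed

lemma neg_log_power:
  "p > 0 \<Longrightarrow> neg_log (p ^ k) = ereal (real k * ln (1 / p))"
  by (simp add: neg_log_def ln_realpow ln_div)

section \<open>Finite combinatorics: thinning, disjoint blocks, sums over stable families\<close>

text \<open>
  Removing one by one the elements whose removal lowers \<open>F\<close> by less than \<open>t\<close>.
\<close>

lemma exists_core_subset:
  fixes F :: "'a set \<Rightarrow> real"
  assumes "finite S" "t \<ge> 0"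
  shows "\<exists>I\<subseteq>S. F I \<ge> F S - real (card S) * t \<and> (\<forall>i\<in>I. F I - F (I - {i}) \<ge> t)"
  using assms(1)
proof (induction "card S" arbitrary: S rule: less_induct)
  case less
  show ?case
  proof (cases "\<forall>i\<in>S. F S - F (S - {i}) \<ge> t")
    case True
    then show ?thesis using \<open>t \<ge> 0\<close> by (intro exI[of _ S]) auto
  next
    case False
    then obtain i where i: "i \<in> S" "F S - F (S - {i}) < t" by force
    have card: "card S = Suc (card (S - {i}))"
      using i(1) less.prems by (metis card_Suc_Diff1)
    obtain I where "I \<subseteq> S - {i}" "F I \<ge> F (S - {i}) - real (card (S - {i})) * t"
      "\<forall>i\<in>I. F I - F (I - {i}) \<ge> t"
      using less.hyps[of "S - {i}"] card less.prems by (metis finite_Diff lessI)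
    moreover from this(2) i(2) have "F I \<ge> F S - real (card S) * t"
      by (simp add: card algebra_simps)
    ultimately show ?thesis by blast
  qed
qed

text \<open>Images of consecutive intervals of length \<open>b\<close> under an enumeration of
  \<open>I\<close>. \<open>F_Un_le_if_minimal\<close> deletes these blocks from \<open>I\<close>,
  one at a time.\<close>

lemma exists_disjoint_blocks:
  assumes "finite I" "n * b \<le> card I"
  shows "\<exists>P :: nat \<Rightarrow> 'a set. (\<forall>k<n. P k \<subseteq> I \<and> card (P k) = b) \<and> disjoint_family_on P {..<n}"
proof -
  obtain f where f: "bij_betw f {0..<card I} I"
    using ex_bij_betw_nat_finite[OF assms(1)] by blast
  define Q where "Q k = {k * b..<k * b + b}" for k
  have sub: "Q k \<subseteq> {0..<card I}" if "k < n" for k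
  proof -
    have "(k + 1) * b \<le> n * b" using that by (intro mult_right_mono) auto
    then have "k * b + b \<le> card I" using assms(2) by (simp add: algebra_simps)
    then show ?thesis unfolding Q_def by auto
  qed
  have disj: "Q j \<inter> Q k = {}" if "j < k" for j k
  proof -
    have "(j + 1) * b \<le> k * b" using that by (intro mult_right_mono) auto
    then have "j * b + b \<le> k * b" by (simp add: algebra_simps)
    then show ?thesis unfolding Q_def by auto
  qed
  have inj: "inj_on f {0..<card I}" using f by (rule bij_betw_imp_inj_on)
  show ?thesis
  proof (intro exI[of _ "\<lambda>k. f ` Q k"] conjI allI impI)
    fix k assume "k < n"
    then show "f ` Q k \<subseteq> I" using sub[of k] bij_betw_imp_surj_on[OF f] by blast
    show "card (f ` Q k) = b"
      using card_image[OF inj_on_subset[OF inj sub[OF \<open>k < n\<close>]]] by (simp add: Q_def)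
  next
    show "disjoint_family_on (\<lambda>k. f ` Q k) {..<n}"
      unfolding disjoint_family_on_def
    proof (intro ballI impI)
      fix j k assume jk: "j \<in> {..<n}" "k \<in> {..<n}" "j \<noteq> k"
      have "Q j \<inter> Q k = {}" using disj[of j k] disj[of k j] jk(3) by (cases "j < k") auto
      then show "f ` Q j \<inter> f ` Q k = {}"
        using inj_on_image_Int[OF inj sub[of j] sub[of k]] jk by auto
    qed
  qed
qed

text \<open>Pigeonhole: a point of \<open>A\<close> chosen in each block would give \<open>n\<close>
  distinct elements of \<open>A\<close>.\<close>

lemma disjoint_family_avoids:
  assumes "finite A" "card A < n" "disjoint_family_on P {..<n}"
  shows "\<exists>k<n. A \<inter> P k = {}"
proof (rule ccontr)
  assume "\<not> ?thesis"
  then have "\<forall>k\<in>{..<n}. \<exists>x. x \<in> A \<inter> P k" by blast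
  then obtain g where g: "\<forall>k\<in>{..<n}. g k \<in> A \<inter> P k" by metis
  have "inj_on g {..<n}"
  proof (rule inj_onI)
    fix j k assume jk: "j \<in> {..<n}" "k \<in> {..<n}" "g j = g k"
    then have "g j \<in> P j \<inter> P k" using g by force
    then show "j = k" using assms(3) jk unfolding disjoint_family_on_def by blast
  qed
  then have "card {..<n} \<le> card A"
    using g assms(1) by (intro card_inj_on_le[of g]) auto
  then show False using assms(2) by simp
qed

text \<open>Group by size. Stability allows at most \<open>(1 / p) powr (\<epsilon> * m / 2)\<close>
  sets of size \<open>m\<close>, so level \<open>m\<close> contributes at most \<open>r ^ m\<close>,
  where \<open>r\<close> is \<open>p\<close> to the power \<open>1 - \<epsilon> / 2\<close>. The
  levels form a geometric series that starts at the smallest size compatible with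
  \<open>a\<close>.\<close>

lemma stable_family_sum_le:
  fixes \<epsilon> p a :: real
  assumes \<epsilon>: "0 < \<epsilon>" "\<epsilon> < 1 / 2" and p: "0 < p" "p \<le> 1 - \<epsilon>"
    and stable: "entropically_stable \<epsilon> p H"
    and sub: "G \<subseteq> H" "\<And>I. I \<in> H \<Longrightarrow> I \<subseteq> {1..N}"
    and large: "\<And>I. I \<in> G \<Longrightarrow> a \<le> real (card I) * ln (1 / p)"
  shows "(\<Sum>I\<in>G. p ^ card I) \<le> 4 / \<epsilon> * exp (- (1 - \<epsilon> / 2) * a)"
proof -
  define L where "L = ln (1 / p)"
  define r where "r = exp (- (1 - \<epsilon> / 2) * L)"
  define m0 where "m0 = nat \<lceil>a / L\<rceil>"
  \<comment> \<open>From \<open>ln p \<le> p - 1 \<le> - \<epsilon>\<close>; this keeps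
    \<open>1 - r\<close> bounded below in terms of \<open>\<epsilon>\<close> alone.\<close>
  have L: "\<epsilon> \<le> L"
  proof -
    have "ln p \<le> - \<epsilon>" using ln_add_one_self_le_self2[of "p - 1"] p \<epsilon> by simp
    then show ?thesis using p by (simp add: L_def ln_div)
  qed
  have L_pos: "L > 0" using L \<epsilon> by linarith
  have r: "0 < r" "r \<le> 1 - \<epsilon> / 4"
  proof -
    have "\<epsilon> / 2 \<le> (1 - \<epsilon> / 2) * L"
    proof -
      have "(1 / 2) * \<epsilon> \<le> (1 - \<epsilon> / 2) * L" using L \<epsilon> by (intro mult_mono) auto
      then show ?thesis by simp
    qed
    then have "r \<le> exp (- (\<epsilon> / 2))" unfolding r_def exp_le_cancel_iff by linarith
    \<comment> \<open>\<open>exp (- x) \<le> 1 / (1 + x) \<le> 1 - x / 2\<close> for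
      \<open>x = \<epsilon> / 2\<close>, the last inequality because
      \<open>0 \<le> x \<le> 1\<close>.\<close>
    also have "\<dots> \<le> 1 - (\<epsilon> / 2) / 2"
    proof -
      have "exp (- (\<epsilon> / 2)) = 1 / exp (\<epsilon> / 2)" by (simp add: exp_minus field_simps)
      also have "\<dots> \<le> 1 / (1 + \<epsilon> / 2)"
        using \<epsilon> exp_ge_add_one_self[of "\<epsilon> / 2"] by (intro divide_left_mono) auto
      also have "\<dots> \<le> 1 - (\<epsilon> / 2) / 2"
      proof -
        have "\<epsilon> * \<epsilon> \<le> \<epsilon> * 1" using \<epsilon> by (intro mult_left_mono) auto
        then have "1 \<le> (1 - (\<epsilon> / 2) / 2) * (1 + \<epsilon> / 2)"
          using \<epsilon> by (simp add: algebra_simps)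
        then show ?thesis using \<epsilon> by (simp add: pos_divide_le_eq)
      qed
      finally show ?thesis .
    qed
    finally show "r \<le> 1 - \<epsilon> / 4" by simp
  qed (simp add: r_def)
  have finH: "finite H" using sub(2) by (intro finite_subset[of H "Pow {1..N}"]) auto
  have finG: "finite G" using finH sub(1) by (rule finite_subset[rotated])
  have card_le: "card I \<le> N" if "I \<in> G" for I
    using card_mono[of "{1..N}" I] sub that by auto
  have stab: "real (card {I \<in> G. card I = m}) * p ^ m \<le> r ^ m" for m
  proof -
    have "card {I \<in> G. card I = m} \<le> card {I \<in> H. int (card I) = int m}"
      using sub(1) finH by (intro card_mono) auto
    then have "real (card {I \<in> G. card I = m}) \<le> real (card {I \<in> H. int (card I) = int m})"
      by simp
    also have "\<dots> \<le> (1 / p) powr (\<epsilon> * real m / 2)"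
      using stable unfolding entropically_stable_def by (metis of_int_of_nat_eq)
    also have "\<dots> = exp (\<epsilon> * real m / 2 * L)"
      using p by (simp add: powr_def L_def)
    finally have "real (card {I \<in> G. card I = m}) * p ^ m \<le> exp (\<epsilon> * real m / 2 * L) * p ^ m"
      using p by (intro mult_right_mono) auto
    moreover have "p ^ m = exp (- real m * L)"
      using p by (simp add: L_def ln_div exp_of_nat_mult)
    moreover have "exp (\<epsilon> * real m / 2 * L) * exp (- real m * L) = r ^ m"
      by (simp add: r_def exp_of_nat_mult[symmetric] exp_add[symmetric] algebra_simps)
    ultimately show ?thesis by (simp only:)
  qed
  have m0: "m0 \<le> card I" if "I \<in> G" for I
  proof -
    have "a / L \<le> real (card I)" using large[OF that] L_pos by (simp add: L_def field_simps)
    then show ?thesis unfolding m0_def by linarith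
  qed
  have m0_ge: "a \<le> real m0 * L"
  proof -
    have "a / L \<le> real m0" unfolding m0_def by linarith
    then show ?thesis using L_pos by (simp add: field_simps)
  qed
  have "(\<Sum>I\<in>G. p ^ card I) = (\<Sum>m\<in>{m0..N}. \<Sum>I\<in>{I \<in> G. card I = m}. p ^ card I)"
    using finG m0 card_le by (intro sum.group[symmetric]) auto
  also have "\<dots> = (\<Sum>m\<in>{m0..N}. real (card {I \<in> G. card I = m}) * p ^ m)"
    by (intro sum.cong) auto
  also have "\<dots> \<le> (\<Sum>m\<in>{m0..N}. r ^ m)"
    by (intro sum_mono stab)
  also have "\<dots> \<le> r ^ m0 / (1 - r)"
    using r \<epsilon> by (auto simp: sum_gp intro!: divide_right_mono)
  \<comment> \<open>The bound \<open>1 - r \<ge> \<epsilon> / 4\<close> is the source of the factor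
    \<open>4 / \<epsilon>\<close>.\<close>
  also have "\<dots> \<le> r ^ m0 / (\<epsilon> / 4)"
    using r \<epsilon> by (intro divide_left_mono) auto
  also have "\<dots> = 4 / \<epsilon> * exp (- (1 - \<epsilon> / 2) * (real m0 * L))"
    by (simp add: r_def exp_of_nat_mult[symmetric] algebra_simps)
  also have "\<dots> \<le> 4 / \<epsilon> * exp (- (1 - \<epsilon> / 2) * a)"
    using m0_ge \<epsilon> by (intro mult_left_mono) auto
  finally show ?thesis .
qed

section \<open>Nonnegative polynomials and their conditional expectations\<close>

locale bernoulli_polynomial =
  fixes N d :: nat and p :: real and \<alpha> :: "nat set \<Rightarrow> real" and X :: "(nat \<Rightarrow> bool) \<Rightarrow> real"
  assumes p_pos: "0 < p" and p_less_1: "p < 1"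
    and coeff_nonneg: "\<And>A. A \<subseteq> {1..N} \<Longrightarrow> \<alpha> A \<ge> 0"
    and coeff_degree: "\<And>A. A \<subseteq> {1..N} \<Longrightarrow> card A > d \<Longrightarrow> \<alpha> A = 0"
    and X_eq: "\<And>y. X y = (\<Sum>A\<in>Pow {1..N}. \<alpha> A * Y_prod A y)"
    and X_nonzero: "X \<noteq> (\<lambda>_. 0)"
begin

text \<open>Closed form of the conditional expectation: in the monomial \<open>A\<close>, variables
  in \<open>S\<close> equal 1 and every other one contributes a factor \<open>p\<close>. The
  identification is \<open>cond_expect_eq_F\<close>; this form makes monotonicity in
  \<open>S\<close> visible.\<close>

definition F :: "nat set \<Rightarrow> real" where
  "F S = (\<Sum>A\<in>Pow {1..N}. \<alpha> A * p ^ card (A - S))"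

lemma X_nonneg: "X y \<ge> 0"
  unfolding X_eq by (intro sum_nonneg mult_nonneg_nonneg coeff_nonneg Y_prod_nonneg) auto

lemma F_mono:
  assumes "S \<subseteq> T"
  shows "F S \<le> F T"
  unfolding F_def
proof (intro sum_mono mult_left_mono power_decreasing)
  fix A assume "A \<in> Pow {1..N}"
  then have "finite A" using finite_subset by auto
  then show "card (A - T) \<le> card (A - S)" using assms by (intro card_mono) auto
qed (use p_pos p_less_1 coeff_nonneg in auto)

lemma F_empty_pos: "F {} > 0"
proof -
  have "\<exists>A\<in>Pow {1..N}. \<alpha> A \<noteq> 0"
  proof (rule ccontr)
    assume "\<not> ?thesis"
    then have "X = (\<lambda>_. 0)" unfolding X_eq by (auto simp: fun_eq_iff)
    then show False using X_nonzero by contradiction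
  qed
  then obtain A where "A \<subseteq> {1..N}" "\<alpha> A \<noteq> 0" by auto
  then have "0 < \<alpha> A * p ^ card (A - {})" using coeff_nonneg[of A] p_pos by simp
  also have "\<dots> \<le> F {}"
    unfolding F_def using \<open>A \<subseteq> {1..N}\<close> p_pos coeff_nonneg
    by (intro member_le_sum[of A "Pow {1..N}" "\<lambda>A. \<alpha> A * p ^ card (A - {})"]) auto
  finally show ?thesis .
qed

text \<open>Monomials living on the support of \<open>y\<close> count fully on both sides; all
  others vanish on the left. Hence the support of a point in the tail is a set with large
  \<open>F\<close>.\<close>

lemma X_le_F_support: "X y \<le> F {i \<in> {1..N}. y i}"
  unfolding X_eq F_def
proof (intro sum_mono mult_left_mono coeff_nonneg)
  fix A assume A: "A \<in> Pow {1..N}"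
  then have fin: "finite A" using finite_subset by auto
  show "Y_prod A y \<le> p ^ card (A - {i \<in> {1..N}. y i})"
  proof (cases "\<forall>i\<in>A. y i")
    case True
    then have "A - {i \<in> {1..N}. y i} = {}" using A by auto
    then show ?thesis using Y_prod_le_1 by (metis card.empty power_0)
  next
    case False
    then have "Y_prod A y = 0" using fin by (auto simp: Y_prod_eq_indicator)
    then show ?thesis using p_pos by simp
  qed
qed auto

text \<open>Multiplying monomials unites their index sets, since the variables are idempotent. The
  free weight \<open>G\<close> lets one expansion serve first, second and truncated higher
  moments.\<close>

lemma expect_Y_mult_X:
  assumes "S \<subseteq> {1..N}"
  shows "expect_Y N p (\<lambda>y. Y_prod S y * (X y * G y)) =
    (\<Sum>A\<in>Pow {1..N}. \<alpha> A * expect_Y N p (\<lambda>y. Y_prod (S \<union> A) y * G y))"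
proof -
  have "Y_prod S y * (X y * G y) = (\<Sum>A\<in>Pow {1..N}. \<alpha> A * (Y_prod (S \<union> A) y * G y))" for y
    unfolding X_eq sum_distrib_left sum_distrib_right
  proof (intro sum.cong refl)
    fix A assume "A \<in> Pow {1..N}"
    then have "finite A" "finite S" using assms finite_subset by auto
    then show "Y_prod S y * (\<alpha> A * Y_prod A y * G y) = \<alpha> A * (Y_prod (S \<union> A) y * G y)"
      by (simp add: Y_prod_Un)
  qed
  then show ?thesis by simp
qed

lemma power_card_Un:
  assumes "S \<subseteq> {1..N}" "A \<subseteq> {1..N}"
  shows "p ^ card (S \<union> A) = p ^ card S * p ^ card (A - S)"
proof -
  have "finite A" "finite S" using assms finite_subset by auto
  then have "card (S \<union> A) = card S + card (A - S)"
    using card_Un_disjoint[of S "A - S"] by auto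
  then show ?thesis by (simp add: power_add)
qed

lemma sum_power_card_Un:
  assumes "S \<subseteq> {1..N}"
  shows "(\<Sum>A\<in>Pow {1..N}. \<alpha> A * p ^ card (S \<union> A)) = p ^ card S * F S"
  unfolding F_def sum_distrib_left using assms
  by (intro sum.cong) (auto simp: power_card_Un)

lemma expect_Y_prod_S: "S \<subseteq> {1..N} \<Longrightarrow> expect_Y N p (Y_prod S) = p ^ card S"
  using p_pos p_less_1 by (intro expect_Y_prod) auto

lemma expect_Y_prod_X:
  assumes "S \<subseteq> {1..N}"
  shows "expect_Y N p (\<lambda>y. Y_prod S y * X y) = p ^ card S * F S"
proof -
  have "expect_Y N p (\<lambda>y. Y_prod S y * X y) =
      (\<Sum>A\<in>Pow {1..N}. \<alpha> A * expect_Y N p (Y_prod (S \<union> A)))"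
    using expect_Y_mult_X[OF assms, of "\<lambda>_. 1"] by simp
  also have "\<dots> = (\<Sum>A\<in>Pow {1..N}. \<alpha> A * p ^ card (S \<union> A))"
    using assms by (intro sum.cong) (auto simp: expect_Y_prod_S)
  finally show ?thesis using sum_power_card_Un[OF assms] by simp
qed

lemma cond_expect_eq_F: "S \<subseteq> {1..N} \<Longrightarrow> cond_expect_Y N p S X = F S"
  using p_pos p_less_1 by (simp add: cond_expect_Y_eq expect_Y_prod_X)

lemma expect_eq_F: "expect_Y N p X = F {}"
  using expect_Y_prod_X[of "{}"] by (simp add: Y_prod_def)

section \<open>Truncated moments and Markov's inequality\<close>

text \<open>Induction on \<open>k\<close>, for all \<open>S\<close> at once. Expanding one factor
  \<open>X\<close> replaces \<open>S\<close> by \<open>S \<union> A\<close>, and summing over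
  \<open>A\<close> produces \<open>p ^ card S * F S\<close>. Either \<open>F S \<le> B\<close>,
  which pays for one factor \<open>B\<close>, or the integrand vanishes.\<close>

lemma truncated_moment_le:
  assumes Z: "\<And>y. 0 \<le> Z y" "\<And>y. Z y \<le> 1"
    and vanish: "\<And>S y. S \<subseteq> {1..N} \<Longrightarrow> card S \<le> M \<Longrightarrow> F S > B \<Longrightarrow> Y_prod S y * Z y = 0"
    and B: "B \<ge> 0"
  shows "S \<subseteq> {1..N} \<Longrightarrow> card S + d * k \<le> M \<Longrightarrow>
    expect_Y N p (\<lambda>y. Y_prod S y * (X y ^ k * Z y)) \<le> p ^ card S * B ^ k"
proof (induction k arbitrary: S)
  case 0
  have "expect_Y N p (\<lambda>y. Y_prod S y * (X y ^ 0 * Z y)) \<le> expect_Y N p (Y_prod S)"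
    using Z by (intro expect_Y_mono) (auto intro: mult_left_le Y_prod_nonneg)
  then show ?case using 0 by (simp add: expect_Y_prod_S)
next
  case (Suc k)
  show ?case
  proof (cases "F S > B")
    case True
    then have "Y_prod S y * Z y = 0" for y using vanish Suc.prems by auto
    then have "(\<lambda>y. Y_prod S y * (X y ^ Suc k * Z y)) = (\<lambda>_. 0)"
      by (metis mult.left_commute mult_zero_right)
    then have "expect_Y N p (\<lambda>y. Y_prod S y * (X y ^ Suc k * Z y)) = 0"
      by (simp only: Bochner_Integration.integral_zero)
    then show ?thesis using p_pos B by (simp only:) simp
  next
    case False
    have "expect_Y N p (\<lambda>y. Y_prod S y * (X y ^ Suc k * Z y)) =
        (\<Sum>A\<in>Pow {1..N}. \<alpha> A * expect_Y N p (\<lambda>y. Y_prod (S \<union> A) y * (X y ^ k * Z y)))"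
      using expect_Y_mult_X[OF Suc.prems(1), of "\<lambda>y. X y ^ k * Z y"] by (simp add: mult.assoc)
    also have "\<dots> \<le> (\<Sum>A\<in>Pow {1..N}. \<alpha> A * (p ^ card (S \<union> A) * B ^ k))"
    proof (rule sum_mono)
      fix A assume A: "A \<in> Pow {1..N}"
      show "\<alpha> A * expect_Y N p (\<lambda>y. Y_prod (S \<union> A) y * (X y ^ k * Z y))
        \<le> \<alpha> A * (p ^ card (S \<union> A) * B ^ k)"
      proof (cases "card A > d")
        case True
        then show ?thesis using A coeff_degree by simp
      next
        case False
        have "card (S \<union> A) + d * k \<le> M"
          using card_Un_le[of S A] False Suc.prems(2) by simp
        then show ?thesis
          using A Suc.prems(1) coeff_nonneg by (intro mult_left_mono Suc.IH) auto
      qed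
    qed
    also have "\<dots> = (\<Sum>A\<in>Pow {1..N}. \<alpha> A * p ^ card (S \<union> A)) * B ^ k"
      by (simp add: sum_distrib_right mult.assoc)
    also have "\<dots> = p ^ card S * F S * B ^ k"
      using sum_power_card_Un[OF Suc.prems(1)] by simp
    also have "\<dots> \<le> p ^ card S * B * B ^ k"
      using False p_pos B by (intro mult_right_mono mult_left_mono) auto
    finally show ?thesis by (simp add: mult.assoc)
  qed
qed

text \<open>Markov's inequality for the \<open>k\<close>-th power, truncated to \<open>Q\<close>.
  The expansion starts from the empty set, so only sets of size at most \<open>d * k\<close>
  arise.\<close>

lemma truncated_tail_le:
  assumes vanish: "\<And>S y. S \<subseteq> {1..N} \<Longrightarrow> card S \<le> d * k \<Longrightarrow> F S > B \<Longrightarrow> Q y \<Longrightarrow> Y_prod S y = 0"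
    and B: "B \<ge> 0" and t: "t > 0"
  shows "prob_Y N p {y. X y \<ge> t \<and> Q y} \<le> (B / t) ^ k"
proof -
  let ?Z = "\<lambda>y. of_bool (Q y) :: real"
  have "prob_Y N p {y. X y \<ge> t \<and> Q y} \<le>
      expect_Y N p (\<lambda>y. Y_prod {} y * (X y ^ k * ?Z y) / t ^ k)"
    unfolding prob_Y_eq_expect using t X_nonneg
    by (intro expect_Y_mono) (auto simp: indicator_def Y_prod_def intro!: power_mono)
  also have "\<dots> = expect_Y N p (\<lambda>y. Y_prod {} y * (X y ^ k * ?Z y)) / t ^ k"
    by simp
  also have "\<dots> \<le> p ^ card ({} :: nat set) * B ^ k / t ^ k"
    using t B vanish
    by (intro divide_right_mono truncated_moment_le[where M = "d * k"]) auto
  finally show ?thesis by (simp add: power_divide)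
qed

section \<open>Lower bound on the tail by a second moment\<close>

text \<open>Paley--Zygmund on the event \<open>Y_prod I y = 1\<close>, with
  \<open>x \<le> x * x / (2 * w) + w / 2\<close> in place of Cauchy--Schwarz where
  \<open>X y \<ge> t\<close>. Expanding one factor of the second moment leaves
  \<open>F (I \<union> A)\<close> with \<open>card A \<le> d\<close>, which \<open>bound\<close>
  controls.\<close>

lemma tail_ge:
  assumes I: "I \<subseteq> {1..N}" and t: "t \<ge> 0" and \<eta>: "\<eta> > 0" and FI: "F I \<ge> t + \<eta>"
    and bound: "\<And>J. J \<subseteq> {1..N} \<Longrightarrow> card J \<le> d \<Longrightarrow> F (I \<union> J) \<le> c"
  shows "prob_Y N p {y. X y \<ge> t} \<ge> \<eta>\<^sup>2 / c\<^sup>2 * p ^ card I"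
proof -
  let ?E = "{y. X y \<ge> t}" and ?P = "p ^ card I"
  \<comment> \<open>With this \<open>w\<close> the second moment term costs at most
    \<open>\<eta> / 2 * ?P\<close>, half of the gain \<open>\<eta> * ?P\<close>; the other half is
    left to the tail.\<close>
  define w where "w = c\<^sup>2 / \<eta>"
  have FIc: "F I \<le> c" using bound[of "{}"] by simp
  then have c: "c > 0" using FI t \<eta> by linarith
  have w: "w > 0" using c \<eta> by (simp add: w_def)
  have P: "?P > 0" using p_pos by simp
  have second: "expect_Y N p (\<lambda>y. Y_prod I y * (X y * X y)) \<le> ?P * c\<^sup>2"
  proof -
    have "expect_Y N p (\<lambda>y. Y_prod I y * (X y * X y)) =
        (\<Sum>A\<in>Pow {1..N}. \<alpha> A * (p ^ card (I \<union> A) * F (I \<union> A)))"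
      unfolding expect_Y_mult_X[OF I] using I by (intro sum.cong) (auto simp: expect_Y_prod_X)
    also have "\<dots> \<le> (\<Sum>A\<in>Pow {1..N}. \<alpha> A * (p ^ card (I \<union> A) * c))"
    proof (rule sum_mono)
      fix A assume A: "A \<in> Pow {1..N}"
      show "\<alpha> A * (p ^ card (I \<union> A) * F (I \<union> A)) \<le> \<alpha> A * (p ^ card (I \<union> A) * c)"
      proof (cases "card A > d")
        case True
        then show ?thesis using A coeff_degree by simp
      next
        case False
        then show ?thesis using A bound p_pos coeff_nonneg by (intro mult_left_mono) auto
      qed
    qed
    also have "\<dots> = (?P * F I) * c"
      unfolding sum_power_card_Un[OF I, symmetric] by (simp add: sum_distrib_right mult.assoc)
    also have "\<dots> \<le> (?P * c) * c" using FIc P c by (intro mult_right_mono mult_left_mono) auto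
    finally show ?thesis by (simp add: power2_eq_square mult.assoc)
  qed
  have "?P * F I = expect_Y N p (\<lambda>y. Y_prod I y * X y)"
    using expect_Y_prod_X[OF I] by simp
  also have "\<dots> \<le> expect_Y N p (\<lambda>y. t * Y_prod I y +
      (Y_prod I y * (X y * X y) / (2 * w) + w / 2 * indicator ?E y))"
  proof (rule expect_Y_mono)
    fix y
    have q: "x \<le> x * x / (2 * w) + w / 2" for x
    proof -
      have "0 \<le> (x - w)\<^sup>2" by simp
      then have "2 * w * x \<le> x * x + w * w" by (simp add: power2_eq_square algebra_simps)
      then have "x \<le> (x * x + w * w) / (2 * w)" using w by (simp add: field_simps)
      then show ?thesis using w by (simp add: add_divide_distrib)
    qed
    show "Y_prod I y * X y \<le> t * Y_prod I y +
      (Y_prod I y * (X y * X y) / (2 * w) + w / 2 * indicator ?E y)"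
    proof (cases "\<forall>i\<in>I. y i")
      case True
      then have "Y_prod I y = 1" using I finite_subset by (auto simp: Y_prod_def)
      moreover have "0 \<le> X y * X y / (2 * w)" using w by simp
      ultimately show ?thesis using q[of "X y"] t by (cases "X y \<ge> t") auto
    next
      case False
      then have "Y_prod I y = 0" using Y_prod_eq_indicator[OF finite_subset[OF I]] by auto
      then show ?thesis using w by simp
    qed
  qed
  also have "\<dots> = t * ?P + (expect_Y N p (\<lambda>y. Y_prod I y * (X y * X y)) / (2 * w) +
      w / 2 * prob_Y N p ?E)"
    by (simp add: expect_Y_prod_S[OF I])
  also have "\<dots> \<le> t * ?P + (?P * c\<^sup>2 / (2 * w) + w / 2 * prob_Y N p ?E)"
    using second w by (intro add_mono divide_right_mono order_refl) auto
  also have "c\<^sup>2 = w * \<eta>" using \<eta> by (simp add: w_def)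
  also have "t * ?P + (?P * (w * \<eta>) / (2 * w) + w / 2 * prob_Y N p ?E) =
      t * ?P + \<eta> / 2 * ?P + w / 2 * prob_Y N p ?E"
    using w by simp
  finally have "?P * F I \<le> t * ?P + \<eta> / 2 * ?P + w / 2 * prob_Y N p ?E" .
  moreover have "?P * (t + \<eta>) \<le> ?P * F I" using FI P by (intro mult_left_mono) auto
  ultimately have "\<eta> * ?P \<le> w * prob_Y N p ?E" by (simp add: algebra_simps)
  then have "\<eta> * ?P / w \<le> prob_Y N p ?E" using w by (simp add: field_simps)
  moreover have "\<eta> * ?P / w = \<eta>\<^sup>2 / c\<^sup>2 * ?P" using \<eta> by (simp add: w_def power2_eq_square)
  ultimately show ?thesis by simp
qed

text \<open>
  A monomial of degree at most \<open>d\<close> misses one of \<open>d + 1\<close> disjoint blocks of \<open>I\<close>; deleting a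
  block of size \<open>d + 1\<close> and adding \<open>J\<close> yields a set that is smaller than \<open>I\<close>.
\<close>

lemma F_Un_le_if_minimal:
  assumes I: "I \<subseteq> {1..N}" "(d + 1) * (d + 1) \<le> card I"
    and small: "\<And>T. T \<subseteq> {1..N} \<Longrightarrow> card T < card I \<Longrightarrow> F T \<le> b"
    and J: "J \<subseteq> {1..N}" "card J \<le> d"
  shows "F (I \<union> J) \<le> real (d + 1) * b"
proof -
  have fin: "finite I" using I(1) finite_subset by blast
  obtain P where P: "\<forall>k<d + 1. P k \<subseteq> I \<and> card (P k) = d + 1" "disjoint_family_on P {..<d + 1}"
    using exists_disjoint_blocks[OF fin I(2)] by blast
  let ?T = "\<lambda>k. (I - P k) \<union> J"
  have "F (I \<union> J) \<le> (\<Sum>A\<in>Pow {1..N}. \<Sum>k<d + 1. \<alpha> A * p ^ card (A - ?T k))"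
    unfolding F_def
  proof (rule sum_mono)
    fix A assume A: "A \<in> Pow {1..N}"
    have nonneg: "0 \<le> \<alpha> A * p ^ card (A - ?T k)" for k using A p_pos coeff_nonneg by simp
    show "\<alpha> A * p ^ card (A - (I \<union> J)) \<le> (\<Sum>k<d + 1. \<alpha> A * p ^ card (A - ?T k))"
    proof (cases "card A > d")
      case True
      then show ?thesis using A coeff_degree by simp
    next
      case False
      moreover have "finite A" using A finite_subset by auto
      ultimately obtain k where k: "k < d + 1" "A \<inter> P k = {}"
        using disjoint_family_avoids[OF _ _ P(2), of A] by auto
      then have "A - (I \<union> J) = A - ?T k" by auto
      then show ?thesis
        using k(1) nonneg member_le_sum[of k "{..<d + 1}" "\<lambda>k. \<alpha> A * p ^ card (A - ?T k)"] by simp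
    qed
  qed
  also have "\<dots> = (\<Sum>k<d + 1. F (?T k))" unfolding F_def by (rule sum.swap)
  also have "\<dots> \<le> (\<Sum>k<d + 1. b)"
  proof (intro sum_mono small)
    fix k assume "k \<in> {..<d + 1}"
    then have k: "P k \<subseteq> I" "card (P k) = d + 1" using P(1) by auto
    show "?T k \<subseteq> {1..N}" using I(1) J(1) by auto
    have "card (I - P k) = card I - (d + 1)"
      using k fin card_Diff_subset finite_subset by metis
    moreover have "d + 1 \<le> card I" using k card_mono[OF fin] by metis
    ultimately show "card (?T k) < card I" using card_Un_le[of "I - P k" J] J(2) by linarith
  qed
  finally show ?thesis by simp
qed

end

section \<open>The rate function \<open>Phi\<close>, cores and tail estimates\<close>

lemma neg_log_ge: "x \<ge> 0 \<Longrightarrow> x \<le> exp (- a) \<Longrightarrow> ereal a \<le> neg_log x"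
proof -
  assume x: "x \<ge> 0" "x \<le> exp (- a)"
  show ?thesis
  proof (cases "x = 0")
    case False
    then have "ln x \<le> ln (exp (- a))" using x by (subst ln_le_cancel_iff) auto
    then show ?thesis using False by (simp add: neg_log_def)
  qed (simp add: neg_log_def)
qed

lemma neg_log_le: "exp (- a) \<le> x \<Longrightarrow> neg_log x \<le> ereal a"
proof -
  assume x: "exp (- a) \<le> x"
  then have "x > 0" using exp_gt_zero[of "- a"] by linarith
  moreover from this have "ln (exp (- a)) \<le> ln x" using x by (subst ln_le_cancel_iff) auto
  ultimately show ?thesis by (simp add: neg_log_def)
qed

context bernoulli_polynomial
begin

lemma ln_p_pos: "ln (1 / p) > 0"
  using p_pos p_less_1 by (simp add: ln_div)

lemma power_p_eq_exp: "p ^ k = exp (- (real k * ln (1 / p)))"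
  using p_pos by (simp add: ln_div exp_of_nat_mult)

lemma neg_log_prob_Y_prod:
  "I \<subseteq> {1..N} \<Longrightarrow> neg_log (prob_Y N p {y. Y_prod I y = 1}) = ereal (real (card I) * ln (1 / p))"
  using p_pos p_less_1 by (simp add: prob_Y_prod neg_log_power)

lemma Phi_le:
  assumes "I \<subseteq> {1..N}" "F I \<ge> (1 + \<delta>) * F {}"
  shows "Phi N p X \<delta> \<le> ereal (real (card I) * ln (1 / p))"
  unfolding Phi_def using assms
  by (intro Inf_lower) (auto simp: neg_log_prob_Y_prod cond_expect_eq_F expect_eq_F intro!: exI[of _ I])

text \<open>The candidate values form a finite set, nonempty when the infimum is not infinite, so
  the infimum is a minimum. In particular \<open>Phi\<close> is then a real number.\<close>

lemma Phi_attained: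
  assumes "Phi N p X \<delta> \<noteq> \<infinity>"
  shows "\<exists>I\<subseteq>{1..N}. F I \<ge> (1 + \<delta>) * F {} \<and> Phi N p X \<delta> = ereal (real (card I) * ln (1 / p))"
proof -
  let ?f = "\<lambda>I. neg_log (prob_Y N p {y. Y_prod I y = 1})"
  let ?S = "{?f I | I. I \<subseteq> {1..N} \<and> cond_expect_Y N p I X \<ge> (1 + \<delta>) * expect_Y N p X}"
  have "?S \<subseteq> ?f ` Pow {1..N}" by auto
  then have fin: "finite ?S" by (rule finite_subset) auto
  have ne: "?S \<noteq> {}"
  proof
    assume "?S = {}"
    then have "Phi N p X \<delta> = \<infinity>" unfolding Phi_def by (simp only: Inf_empty top_ereal_def)
    then show False using assms by contradiction
  qed
  have "Phi N p X \<delta> = Min ?S" unfolding Phi_def by (rule Min_Inf[OF fin ne, symmetric])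
  then have "Phi N p X \<delta> \<in> ?S" using Min_in[OF fin ne] by simp
  then obtain I where "Phi N p X \<delta> = ?f I" "I \<subseteq> {1..N}"
      "cond_expect_Y N p I X \<ge> (1 + \<delta>) * expect_Y N p X"
    by blast
  then show ?thesis
    by (intro exI[of _ I]) (simp add: neg_log_prob_Y_prod cond_expect_eq_F expect_eq_F)
qed

text \<open>If some member of \<open>H\<close> occurs but none of \<open>H - G\<close>, a member of
  \<open>G\<close> occurs. Taking \<open>G = H\<close> bounds the whole tail; taking for
  \<open>G\<close> the cores that are not small bounds the part missed by small cores.\<close>

lemma prob_Y_union_bound:
  assumes "finite G" "\<And>I. I \<in> H \<Longrightarrow> I \<subseteq> {1..N}" "G \<subseteq> H"
  shows "prob_Y N p {y. Q y \<and> (\<forall>I\<in>H - G. Y_prod I y = 0)}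
    \<le> prob_Y N p {y. Q y \<and> (\<forall>I\<in>H. Y_prod I y = 0)} + (\<Sum>I\<in>G. p ^ card I)"
proof -
  let ?A = "{y. Q y \<and> (\<forall>I\<in>H - G. Y_prod I y = 0)}" and ?B = "{y. Q y \<and> (\<forall>I\<in>H. Y_prod I y = 0)}"
  have "prob_Y N p ?A \<le> expect_Y N p (\<lambda>y. indicator ?B y + (\<Sum>I\<in>G. Y_prod I y))"
    unfolding prob_Y_eq_expect
  proof (rule expect_Y_mono)
    fix y
    have nonneg: "(\<Sum>I\<in>G. Y_prod I y) \<ge> 0" by (intro sum_nonneg Y_prod_nonneg)
    show "indicat_real ?A y \<le> indicator ?B y + (\<Sum>I\<in>G. Y_prod I y)"
    proof (cases "y \<in> ?A - ?B")
      case True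
      then obtain I where I: "I \<in> G" "Y_prod I y \<noteq> 0" by auto
      then have "finite I" using assms(2,3) finite_subset by blast
      then have "Y_prod I y = 1" using I(2) by (simp add: Y_prod_eq_indicator)
      then have "1 \<le> (\<Sum>I\<in>G. Y_prod I y)"
        using member_le_sum[OF I(1), of "\<lambda>I. Y_prod I y"] assms(1) Y_prod_nonneg by simp
      then show ?thesis using True by (auto simp: indicator_def)
    next
      case False
      then show ?thesis using nonneg by (auto simp: indicator_def)
    qed
  qed
  also have "\<dots> = prob_Y N p ?B + (\<Sum>I\<in>G. expect_Y N p (Y_prod I))" by simp
  also have "(\<Sum>I\<in>G. expect_Y N p (Y_prod I)) = (\<Sum>I\<in>G. p ^ card I)"
    using assms by (intro sum.cong expect_Y_prod_S) auto
  finally show ?thesis .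
qed

text \<open>The level \<open>B\<close> lies midway between the core threshold and the tail
  threshold: the lower gap absorbs the loss in thinning \<open>S\<close> to a core, the upper gap
  makes the ratio in Markov's inequality less than 1.\<close>

lemma coreless_tail_le:
  assumes \<epsilon>: "0 < \<epsilon>" "\<epsilon> < 1 / 2" and \<delta>: "\<delta> > 0"
    and Phi: "Phi N p X (\<delta> + \<epsilon>) = ereal \<phi>" and \<phi>: "\<phi> \<ge> 1"
    and K: "K > 0" "2 * real d * (4 * (1 + \<delta>) / \<epsilon> + 1) / \<epsilon> \<le> K"
  shows "prob_Y N p {y. X y \<ge> (1 + \<delta>) * F {} \<and>
      (\<forall>I\<in>core_family N p X \<epsilon> \<delta> K. Y_prod I y = 0)} \<le> exp (- 2 * \<phi>)"
proof -
  \<comment> \<open>Chosen so that \<open>c * (\<epsilon> / (2 * (1 + \<delta>))) = 2\<close>, which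
    gives the exponent \<open>2 * \<phi>\<close>.\<close>
  define c where "c = 4 * (1 + \<delta>) / \<epsilon>"
  define k where "k = nat \<lceil>c * \<phi>\<rceil>"
  define B where "B = (1 + \<delta> - \<epsilon> / 2) * F {}"
  \<comment> \<open>The increment demanded by (C3).\<close>
  define \<tau> where "\<tau> = F {} / (K * \<phi>)"
  have c: "c > 0" using \<epsilon> \<delta> by (simp add: c_def)
  have k_ge: "c * \<phi> \<le> real k" unfolding k_def by linarith
  have k_le: "real k \<le> (c + 1) * \<phi>"
  proof -
    have "c * \<phi> \<ge> 0" using c \<phi> by simp
    then have "real k \<le> c * \<phi> + 1" unfolding k_def by linarith
    then show ?thesis using \<phi> by (simp add: algebra_simps)
  qed
  \<comment> \<open>The lower bound on \<open>K\<close> is made for this: thinning a set of size at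
    most \<open>d * k\<close> then loses at most \<open>\<epsilon> / 2 * F {}\<close>.\<close>
  have dk: "real d * real k \<le> \<epsilon> / 2 * (K * \<phi>)"
  proof -
    have "real d * real k \<le> real d * ((c + 1) * \<phi>)" using k_le by (intro mult_left_mono) auto
    also have "real d * (c + 1) \<le> \<epsilon> / 2 * K" using K(2) \<epsilon> by (simp add: c_def field_simps)
    then have "real d * (c + 1) * \<phi> \<le> \<epsilon> / 2 * K * \<phi>" using \<phi> by (intro mult_right_mono) auto
    then have "real d * ((c + 1) * \<phi>) \<le> \<epsilon> / 2 * (K * \<phi>)" by (simp only: mult.assoc)
    finally show ?thesis .
  qed
  have K\<phi>: "K * \<phi> > 0" using K(1) \<phi> by simp
  have \<tau>: "\<tau> \<ge> 0" using F_empty_pos K\<phi> by (simp add: \<tau>_def)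
  have "prob_Y N p {y. X y \<ge> (1 + \<delta>) * F {} \<and>
      (\<forall>I\<in>core_family N p X \<epsilon> \<delta> K. Y_prod I y = 0)} \<le> (B / ((1 + \<delta>) * F {})) ^ k"
  proof (rule truncated_tail_le)
    fix S y
    assume S: "S \<subseteq> {1..N}" "card S \<le> d * k" "F S > B"
      and none: "\<forall>I\<in>core_family N p X \<epsilon> \<delta> K. Y_prod I y = 0"
    have finS: "finite S" using S(1) finite_subset by blast
    obtain I where I: "I \<subseteq> S" "F I \<ge> F S - real (card S) * \<tau>" "\<forall>i\<in>I. F I - F (I - {i}) \<ge> \<tau>"
      using exists_core_subset[OF finS \<tau>, of F] by blast
    have IN: "I \<subseteq> {1..N}" using I(1) S(1) by auto
    have cS: "real (card S) \<le> \<epsilon> / 2 * (K * \<phi>)"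
    proof -
      have "real (card S) \<le> real (d * k)" using S(2) by (simp only: of_nat_le_iff)
      then show ?thesis using dk by simp
    qed
    have "real (card S) * \<tau> \<le> \<epsilon> / 2 * (K * \<phi>) * \<tau>" using cS \<tau> by (rule mult_right_mono)
    also have "\<dots> = \<epsilon> / 2 * F {}" using K(1) \<phi> by (simp add: \<tau>_def)
    finally have "F I \<ge> (1 + \<delta> - \<epsilon>) * F {}"
      using I(2) S(3) by (simp add: B_def algebra_simps)
    moreover have "real (card I) \<le> K * \<phi>"
    proof -
      have "real (card I) \<le> real (card S)" using card_mono[OF finS I(1)] by simp
      also have "\<dots> \<le> \<epsilon> / 2 * (K * \<phi>)" by (rule cS)
      also have "\<dots> \<le> 1 * (K * \<phi>)" using \<epsilon> K\<phi> by (intro mult_right_mono) auto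
      finally show ?thesis by simp
    qed
    moreover have "cond_expect_Y N p (I - {i}) X = F (I - {i})" for i
      using IN by (intro cond_expect_eq_F) auto
    moreover have "ereal (F {}) / (ereal K * ereal \<phi>) = ereal \<tau>"
      using K(1) \<phi> by (simp add: \<tau>_def)
    ultimately have "I \<in> core_family N p X \<epsilon> \<delta> K"
      unfolding core_family_def using IN I(3)
      by (simp add: cond_expect_eq_F expect_eq_F Phi)
    then have "Y_prod I y = 0" using none by blast
    then show "Y_prod S y = 0"
      using I(1) finS finite_subset[OF I(1) finS] by (auto simp: Y_prod_eq_indicator)
  qed (use F_empty_pos \<epsilon> \<delta> in \<open>auto simp: B_def\<close>)
  also have "B / ((1 + \<delta>) * F {}) = 1 - \<epsilon> / (2 * (1 + \<delta>))"
  proof -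
    have "(1 - \<epsilon> / (2 * u)) * u = u - \<epsilon> / 2" if "u > 0" for u
      using that by (simp add: field_simps)
    from this[of "1 + \<delta>"] have "(1 - \<epsilon> / (2 * (1 + \<delta>))) * (1 + \<delta>) = 1 + \<delta> - \<epsilon> / 2"
      using \<delta> by (simp only: add_pos_pos zero_less_one)
    then have "B = (1 - \<epsilon> / (2 * (1 + \<delta>))) * ((1 + \<delta>) * F {})"
      by (simp only: B_def mult.assoc[symmetric])
    moreover have "(1 + \<delta>) * F {} \<noteq> 0" using F_empty_pos \<delta> by simp
    ultimately show ?thesis by (metis nonzero_mult_div_cancel_right)
  qed
  also have "(1 - \<epsilon> / (2 * (1 + \<delta>))) ^ k \<le> exp (- (\<epsilon> / (2 * (1 + \<delta>)))) ^ k"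
    using exp_ge_add_one_self[of "- (\<epsilon> / (2 * (1 + \<delta>)))"] \<epsilon> \<delta>
    by (intro power_mono) (auto simp: field_simps)
  also have "\<dots> = exp (- (real k * (\<epsilon> / (2 * (1 + \<delta>)))))"
    by (simp add: exp_of_nat_mult[symmetric])
  also have "\<dots> \<le> exp (- (c * \<phi> * (\<epsilon> / (2 * (1 + \<delta>)))))"
  proof -
    have "c * \<phi> * (\<epsilon> / (2 * (1 + \<delta>))) \<le> real k * (\<epsilon> / (2 * (1 + \<delta>)))"
      using k_ge \<epsilon> \<delta> by (intro mult_right_mono) auto
    then show ?thesis by simp
  qed
  also have "c * \<phi> * (\<epsilon> / (2 * (1 + \<delta>))) = 2 * \<phi>"
  proof -
    have "4 * u / \<epsilon> * \<phi> * (\<epsilon> / (2 * u)) = 2 * \<phi>" if "u > 0" for u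
      using that \<epsilon> by simp
    from this[of "1 + \<delta>"] show ?thesis
      unfolding c_def using \<delta> by (simp only: add_pos_pos zero_less_one)
  qed
  finally show ?thesis by simp
qed

text \<open>Here (C2) is vacuous and the threshold in (C3) is 0, so by monotonicity of
  \<open>F\<close> the support of \<open>y\<close> is itself a core.\<close>

lemma exists_core_if_Phi_infinite:
  assumes "\<epsilon> \<ge> 0" and "K > 0" and "Phi N p X (\<delta> + \<epsilon>) = \<infinity>" and "X y \<ge> (1 + \<delta>) * F {}"
  shows "\<exists>I\<in>core_family N p X \<epsilon> \<delta> K. Y_prod I y \<noteq> 0"
proof
  let ?I = "{i \<in> {1..N}. y i}"
  have "(1 + \<delta> - \<epsilon>) * F {} \<le> (1 + \<delta>) * F {}"
    using assms(1) F_empty_pos by (intro mult_right_mono) auto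
  then have "F ?I \<ge> (1 + \<delta> - \<epsilon>) * F {}"
    using assms(4) X_le_F_support[of y] by linarith
  moreover have "cond_expect_Y N p (?I - {i}) X = F (?I - {i})" for i
    by (intro cond_expect_eq_F) auto
  moreover have "F (?I - {i}) \<le> F ?I" for i by (rule F_mono) auto
  moreover have "?I \<subseteq> {1..N}" by auto
  moreover have "cond_expect_Y N p ?I X = F ?I"
    by (intro cond_expect_eq_F) auto
  ultimately show "?I \<in> core_family N p X \<epsilon> \<delta> K"
    unfolding core_family_def using assms(2) by (simp add: expect_eq_F assms(3))
  show "Y_prod ?I y \<noteq> 0" by (simp add: Y_prod_eq_indicator)
qed

text \<open>Take a minimiser \<open>I\<close> for \<open>Phi\<close>: smaller sets are not
  admissible, so \<open>F_Un_le_if_minimal\<close> supplies the bound for \<open>tail_ge\<close>,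
  with \<open>\<eta> = \<epsilon> * F {}\<close>.\<close>

lemma tail_ge_Phi:
  assumes \<epsilon>: "0 < \<epsilon>" and \<delta>: "\<delta> > 0" and Phi: "Phi N p X (\<delta> + \<epsilon>) = ereal \<phi>"
    and large: "real ((d + 1) * (d + 1)) * ln (1 / p) \<le> \<phi>"
  shows "prob_Y N p {y. X y \<ge> (1 + \<delta>) * F {}} \<ge>
    \<epsilon>\<^sup>2 / (real (d + 1) * (1 + \<delta> + \<epsilon>))\<^sup>2 * exp (- \<phi>)"
proof -
  let ?C = "real (d + 1) * (1 + \<delta> + \<epsilon>)"
  obtain I where I: "I \<subseteq> {1..N}" "F I \<ge> (1 + (\<delta> + \<epsilon>)) * F {}" "\<phi> = real (card I) * ln (1 / p)"
    using Phi_attained[of "\<delta> + \<epsilon>"] Phi by auto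
  \<comment> \<open>\<open>large\<close> says that \<open>I\<close> has room for
    \<open>d + 1\<close> disjoint blocks of size \<open>d + 1\<close>.\<close>
  have "real ((d + 1) * (d + 1)) \<le> real (card I)"
    using large ln_p_pos unfolding I(3) by (simp only: mult_le_cancel_right_pos)
  then have card_I: "(d + 1) * (d + 1) \<le> card I" by (simp only: of_nat_le_iff)
  have small: "F T \<le> (1 + \<delta> + \<epsilon>) * F {}" if T: "T \<subseteq> {1..N}" "card T < card I" for T
  proof (rule ccontr)
    assume "\<not> ?thesis"
    then have "F T \<ge> (1 + (\<delta> + \<epsilon>)) * F {}" by (simp add: algebra_simps)
    then have "ereal (real (card I) * ln (1 / p)) \<le> ereal (real (card T) * ln (1 / p))"
      using Phi_le[OF T(1)] Phi I(3) by metis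
    then show False using T(2) ln_p_pos by (simp add: ln_div)
  qed
  have "(\<epsilon> * F {})\<^sup>2 / (real (d + 1) * ((1 + \<delta> + \<epsilon>) * F {}))\<^sup>2 * p ^ card I
      \<le> prob_Y N p {y. X y \<ge> (1 + \<delta>) * F {}}"
  proof (rule tail_ge[OF I(1)])
    show "F (I \<union> J) \<le> real (d + 1) * ((1 + \<delta> + \<epsilon>) * F {})" if "J \<subseteq> {1..N}" "card J \<le> d" for J
      using F_Un_le_if_minimal[OF I(1) card_I small that] .
  qed (use F_empty_pos \<epsilon> \<delta> I(2) in \<open>auto simp: algebra_simps\<close>)
  moreover have "(\<epsilon> * F {})\<^sup>2 / (real (d + 1) * ((1 + \<delta> + \<epsilon>) * F {}))\<^sup>2 = \<epsilon>\<^sup>2 / ?C\<^sup>2"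
    using F_empty_pos by (simp add: power_mult_distrib)
  moreover have "p ^ card I = exp (- \<phi>)" using power_p_eq_exp I(3) by simp
  ultimately show ?thesis by (simp only:)
qed

end

section \<open>Choice of the constant and assembly of the estimates\<close>

theorem theorem3p1:
  fixes d :: nat and \<epsilon> \<delta> :: real
  assumes "d > 0" and "\<epsilon> > 0" and "\<delta> > 0" and "\<epsilon> < 1 / 2"
  shows "\<exists>K::real. K > 0 \<and>
    (\<forall>(N::nat) (p::real) (X :: (nat \<Rightarrow> bool) \<Rightarrow> real).
       0 < p \<longrightarrow> p \<le> 1 - \<epsilon> \<longrightarrow>
       nonneg_poly N d X \<longrightarrow> X \<noteq> (\<lambda>_. 0) \<longrightarrow>
       Phi N p X (\<delta> - \<epsilon>) \<ge> ereal (K * ln (1 / p)) \<longrightarrow>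
       entropically_stable \<epsilon> p (core_family N p X \<epsilon> \<delta> K) \<longrightarrow>
       ereal (1 - \<epsilon>) * Phi N p X (\<delta> - \<epsilon>)
         \<le> neg_log (prob_Y N p {y. X y \<ge> (1 + \<delta>) * expect_Y N p X}) \<and>
       neg_log (prob_Y N p {y. X y \<ge> (1 + \<delta>) * expect_Y N p X})
         \<le> ereal (1 + \<epsilon>) * Phi N p X (\<delta> + \<epsilon>) \<and>
       prob_Y N p {y. X y \<ge> (1 + \<delta>) * expect_Y N p X \<and>
                      (\<forall>I \<in> small_core_family N p X \<epsilon> \<delta> K. Y_prod I y = 0)}
         \<le> \<epsilon> * prob_Y N p {y. X y \<ge> (1 + \<delta>) * expect_Y N p X})"
proof -
  \<comment> \<open>\<open>C\<close> comes from \<open>stable_family_sum_le\<close> and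
    \<open>c\<close> from \<open>tail_ge_Phi\<close>. \<open>M\<close> solves
    \<open>1 + C = M * (\<epsilon> * c)\<close> and dominates every constant to be absorbed.\<close>
  define C where "C = 4 / \<epsilon>"
  define c where "c = \<epsilon>\<^sup>2 / (real (d + 1) * (1 + \<delta> + \<epsilon>))\<^sup>2"
  define M where "M = (1 + C) / (\<epsilon> * c)"
  \<comment> \<open>\<open>K1\<close> is needed for \<open>coreless_tail_le\<close> and
    \<open>K2\<close> for the blocks. If \<open>x \<ge> K * ln (1 / p)\<close>, hence
    \<open>x \<ge> K * \<epsilon>\<close>, then \<open>K3\<close> makes
    \<open>exp (- (\<epsilon> / 4) * x)\<close> beat \<open>M\<close> and
    \<open>1 / \<epsilon>\<close> gives \<open>x \<ge> 1\<close>.\<close>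
  define K1 where "K1 = 2 * real d * (4 * (1 + \<delta>) / \<epsilon> + 1) / \<epsilon>"
  define K2 where "K2 = real ((d + 1) * (d + 1))"
  define K3 where "K3 = 4 * ln M / \<epsilon>\<^sup>2"
  define K where "K = K1 + K2 + K3 + 1 / \<epsilon>"
  have C: "C > 0" using assms by (simp add: C_def)
  have c: "c > 0" "c \<le> 1"
  proof -
    show "c > 0" using assms by (simp add: c_def add_pos_pos)
    have "1 * \<epsilon> \<le> real (d + 1) * (1 + \<delta> + \<epsilon>)" using assms by (intro mult_mono) auto
    then have "\<epsilon>\<^sup>2 \<le> (real (d + 1) * (1 + \<delta> + \<epsilon>))\<^sup>2" using assms by (intro power_mono) auto
    then show "c \<le> 1" unfolding c_def by (intro divide_le_eq_1[THEN iffD2]) (use assms in auto)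
  qed
  have \<epsilon>c: "\<epsilon> * c > 0" "\<epsilon> * c \<le> c" "\<epsilon> * c \<le> 1"
    using c assms mult_mono[of \<epsilon> 1 c 1] by auto
  have M: "M \<ge> 1 + C" "1 / c \<le> M" "M \<ge> 1"
  proof -
    have "(1 + C) / 1 \<le> M" unfolding M_def using \<epsilon>c C by (intro divide_left_mono) auto
    then show "M \<ge> 1 + C" by simp
    then show "M \<ge> 1" using C by simp
    show "1 / c \<le> M" unfolding M_def using \<epsilon>c C by (intro frac_le) auto
  qed
  have K_parts: "K1 \<ge> 0" "K2 \<ge> 0" "K3 \<ge> 0" "1 / \<epsilon> > 0"
    using assms M(3) by (auto simp: K1_def K2_def K3_def)
  then have K: "K > 0" "K1 \<le> K" "K2 \<le> K" "K3 \<le> K" "1 / \<epsilon> \<le> K"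
    unfolding K_def by linarith+
  show ?thesis
  proof (intro exI[of _ K] conjI[OF K(1)] allI impI)
    fix N p X
    assume p: "0 < p" "p \<le> 1 - \<epsilon>" and poly: "nonneg_poly N d X" and nz: "X \<noteq> (\<lambda>_. 0)"
      and Phi_ge: "Phi N p X (\<delta> - \<epsilon>) \<ge> ereal (K * ln (1 / p))"
      and stable: "entropically_stable \<epsilon> p (core_family N p X \<epsilon> \<delta> K)"
    obtain \<alpha> where "\<forall>I\<subseteq>{1..N}. \<alpha> I \<ge> 0" "\<forall>I\<subseteq>{1..N}. card I > d \<longrightarrow> \<alpha> I = 0"
      "\<forall>y. X y = (\<Sum>I\<in>Pow {1..N}. \<alpha> I * Y_prod I y)"
      using poly unfolding nonneg_poly_def by blast
    then interpret bernoulli_polynomial N d p \<alpha> X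
      using p nz assms by unfold_locales auto
    let ?core = "core_family N p X \<epsilon> \<delta> K" and ?small = "small_core_family N p X \<epsilon> \<delta> K"
    let ?L = "ln (1 / p)" and ?t = "(1 + \<delta>) * F {}"
    let ?P = "prob_Y N p {y. X y \<ge> ?t}"
    let ?Q = "prob_Y N p {y. X y \<ge> ?t \<and> (\<forall>I\<in>?core. Y_prod I y = 0)}"
    let ?R = "prob_Y N p {y. X y \<ge> ?t \<and> (\<forall>I\<in>?small. Y_prod I y = 0)}"
    have L: "\<epsilon> \<le> ?L"
    proof -
      have "ln p \<le> - \<epsilon>" using ln_add_one_self_le_self2[of "p - 1"] p assms by simp
      then show ?thesis using p by (simp add: ln_div)
    qed
    have large: "1 \<le> x" "exp (- (\<epsilon> / 4) * x) * M \<le> 1" "K2 * ?L \<le> x" if "K * ?L \<le> x" for x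
    proof -
      have "K * \<epsilon> \<le> K * ?L" using L K(1) by (intro mult_left_mono) auto
      then have Kx: "K * \<epsilon> \<le> x" using that by linarith
      moreover have "1 / \<epsilon> * \<epsilon> \<le> K * \<epsilon>" using K(5) assms by (intro mult_right_mono) auto
      ultimately show "1 \<le> x" using assms by simp
      have "K3 * \<epsilon> \<le> x" using Kx mult_right_mono[OF K(4), of \<epsilon>] assms by linarith
      then have "\<epsilon> / 4 * (K3 * \<epsilon>) \<le> \<epsilon> / 4 * x" using assms by (intro mult_left_mono) auto
      moreover have "\<epsilon> / 4 * (K3 * \<epsilon>) = ln M" using assms by (simp add: K3_def power2_eq_square)
      ultimately have "ln M \<le> \<epsilon> / 4 * x" by simp
      then have "exp (- (\<epsilon> / 4) * x) * exp (ln M) \<le> exp 0"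
        unfolding exp_add[symmetric] exp_le_cancel_iff by simp
      then show "exp (- (\<epsilon> / 4) * x) * M \<le> 1" using M(3) by simp
      have "K2 * ?L \<le> K * ?L" using K(3) ln_p_pos by (intro mult_right_mono) auto
      then show "K2 * ?L \<le> x" using that by linarith
    qed
    have core_sub: "I \<subseteq> {1..N}" if "I \<in> ?core" for I
      using that by (simp add: core_family_def)
    have core_fin: "finite ?core"
      by (rule finite_subset[of _ "Pow {1..N}"]) (use core_sub in blast, simp)
    \<comment> \<open>(C1) makes every core a candidate in the minimum defining
      \<open>Phi N p X (\<delta> - \<epsilon>)\<close>.\<close>
    have core_large: "Phi N p X (\<delta> - \<epsilon>) \<le> ereal (real (card I) * ?L)" if "I \<in> ?core" for I
      using that by (intro Phi_le) (auto simp: core_family_def cond_expect_eq_F expect_eq_F add_diff_eq)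
    have Q_infinite: "?Q = 0" if "Phi N p X (\<delta> + \<epsilon>) = \<infinity>"
    proof -
      have "{y. X y \<ge> ?t \<and> (\<forall>I\<in>?core. Y_prod I y = 0)} = {}"
        using exists_core_if_Phi_infinite[OF _ K(1) that] assms by fastforce
      then show ?thesis by (simp only: measure_empty)
    qed
    \<comment> \<open>A minimiser at \<open>\<delta> + \<epsilon>\<close> is admissible at
      \<open>\<delta> - \<epsilon>\<close>, so the assumed lower bound on \<open>Phi\<close> passes
      to \<open>\<phi>\<close> and \<open>large\<close> applies.\<close>
    have finite_case: "ereal (K * ?L) \<le> ereal \<phi>" "Phi N p X (\<delta> - \<epsilon>) \<le> ereal \<phi>"
      "?Q \<le> exp (- 2 * \<phi>)" "?P \<ge> c * exp (- \<phi>)" "1 \<le> \<phi>" "exp (- (\<epsilon> / 4) * \<phi>) * M \<le> 1"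
      if Phi: "Phi N p X (\<delta> + \<epsilon>) = ereal \<phi>" for \<phi>
    proof -
      obtain I where I: "I \<subseteq> {1..N}" "F I \<ge> (1 + (\<delta> + \<epsilon>)) * F {}" "\<phi> = real (card I) * ?L"
        using Phi_attained[of "\<delta> + \<epsilon>"] Phi by auto
      have "(1 + (\<delta> - \<epsilon>)) * F {} \<le> (1 + (\<delta> + \<epsilon>)) * F {}"
        using assms F_empty_pos by (intro mult_right_mono) auto
      then show le: "Phi N p X (\<delta> - \<epsilon>) \<le> ereal \<phi>"
        using Phi_le[OF I(1), of "\<delta> - \<epsilon>"] I(2,3) by simp
      then show *: "ereal (K * ?L) \<le> ereal \<phi>" using Phi_ge by (rule order_trans[rotated])
      then have \<phi>: "K * ?L \<le> \<phi>" by simp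
      show "1 \<le> \<phi>" "exp (- (\<epsilon> / 4) * \<phi>) * M \<le> 1" using large[OF \<phi>] by auto
      show "?Q \<le> exp (- 2 * \<phi>)"
        using assms K(1) K(2)[unfolded K1_def] large(1)[OF \<phi>] Phi by (intro coreless_tail_le) auto
      show "?P \<ge> c * exp (- \<phi>)"
        using tail_ge_Phi[OF assms(2,3) Phi] large(3)[OF \<phi>] unfolding c_def K2_def by simp
    qed

    have lower: "ereal (1 - \<epsilon>) * Phi N p X (\<delta> - \<epsilon>) \<le> neg_log ?P"
    proof (cases "Phi N p X (\<delta> - \<epsilon>)")
      case (real a)
      have a: "K * ?L \<le> a" using Phi_ge real by simp
      have "?P \<le> ?Q + (\<Sum>I\<in>?core. p ^ card I)"
        using prob_Y_union_bound[OF core_fin core_sub order_refl, of "\<lambda>y. X y \<ge> ?t"] by simp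
      also have "\<dots> \<le> exp (- (1 - \<epsilon> / 2) * a) + C * exp (- (1 - \<epsilon> / 2) * a)"
      proof (rule add_mono)
        show "(\<Sum>I\<in>?core. p ^ card I) \<le> C * exp (- (1 - \<epsilon> / 2) * a)"
          unfolding C_def
          using assms p stable core_sub core_large real
          by (intro stable_family_sum_le[where H = ?core and N = N]) auto
        show "?Q \<le> exp (- (1 - \<epsilon> / 2) * a)"
        proof (cases "Phi N p X (\<delta> + \<epsilon>) = \<infinity>")
          case True
          then show ?thesis using Q_infinite by simp
        next
          case False
          then obtain \<phi> where \<phi>: "Phi N p X (\<delta> + \<epsilon>) = ereal \<phi>"
            using Phi_attained by blast
          have "a \<le> \<phi>" using finite_case(2)[OF \<phi>] real by simp
          moreover have "1 \<le> \<phi>" by (rule finite_case(5)[OF \<phi>])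
          moreover have "(1 - \<epsilon> / 2) * a \<le> 1 * a"
            using large(1)[OF a] assms by (intro mult_right_mono) auto
          ultimately have "- 2 * \<phi> \<le> - (1 - \<epsilon> / 2) * a" by linarith
          then have "exp (- 2 * \<phi>) \<le> exp (- (1 - \<epsilon> / 2) * a)" by (simp only: exp_le_cancel_iff)
          then show ?thesis using finite_case(3)[OF \<phi>] by linarith
        qed
      qed
      also have "\<dots> = (1 + C) * exp (- (1 - \<epsilon> / 2) * a)" by (simp add: algebra_simps)
      \<comment> \<open>Weakening \<open>1 - \<epsilon> / 2\<close> to \<open>1 - \<epsilon>\<close>
        frees \<open>\<epsilon> / 2 * a\<close> in the exponent; half of it absorbs
        \<open>M\<close>.\<close>
      also have "\<dots> \<le> M * (exp (- (1 - \<epsilon>) * a) * exp (- (\<epsilon> / 4) * a))"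
      proof (rule mult_mono)
        have "\<epsilon> / 4 * a \<le> \<epsilon> / 2 * a" using large(1)[OF a] assms by (intro mult_right_mono) auto
        then have "- (1 - \<epsilon> / 2) * a \<le> - (1 - \<epsilon>) * a + - (\<epsilon> / 4) * a" by (simp add: algebra_simps)
        then show "exp (- (1 - \<epsilon> / 2) * a) \<le> exp (- (1 - \<epsilon>) * a) * exp (- (\<epsilon> / 4) * a)"
          unfolding exp_add[symmetric] by (simp only: exp_le_cancel_iff)
      qed (use M in auto)
      also have "\<dots> = exp (- (1 - \<epsilon>) * a) * (exp (- (\<epsilon> / 4) * a) * M)" by (simp only: ac_simps)
      also have "\<dots> \<le> exp (- (1 - \<epsilon>) * a) * 1"
        using large(2)[OF a] by (intro mult_left_mono) auto
      finally have "?P \<le> exp (- ((1 - \<epsilon>) * a))" by (simp only: mult_1_right mult_minus_left)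
      then have "ereal ((1 - \<epsilon>) * a) \<le> neg_log ?P" by (intro neg_log_ge) auto
      then show ?thesis using real by simp
    next
      case PInf
      \<comment> \<open>Otherwise the support of \<open>y\<close> would be a candidate and
        \<open>Phi\<close> would be finite.\<close>
      have "X y < ?t" for y
      proof (rule ccontr)
        let ?I = "{i \<in> {1..N}. y i}"
        assume "\<not> X y < ?t"
        moreover have "(1 + (\<delta> - \<epsilon>)) * F {} \<le> ?t"
          using assms F_empty_pos by (intro mult_right_mono) auto
        ultimately have "(1 + (\<delta> - \<epsilon>)) * F {} \<le> F ?I"
          using X_le_F_support[of y] by linarith
        then have "Phi N p X (\<delta> - \<epsilon>) \<le> ereal (real (card ?I) * ?L)" by (intro Phi_le) auto
        then show False using PInf by simp
      qed
      then have "{y. X y \<ge> ?t} = {}" by (auto simp: not_le)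
      then have "?P = 0" by (simp only: measure_empty)
      then show ?thesis by (simp add: neg_log_def)
    qed (use Phi_ge in auto)

    have upper: "neg_log ?P \<le> ereal (1 + \<epsilon>) * Phi N p X (\<delta> + \<epsilon>)"
    proof (cases "Phi N p X (\<delta> + \<epsilon>) = \<infinity>")
      case True
      then show ?thesis using assms by simp
    next
      case False
      then obtain \<phi> where \<phi>: "Phi N p X (\<delta> + \<epsilon>) = ereal \<phi>"
        using Phi_attained by blast
      \<comment> \<open>The spare factor \<open>exp (- \<epsilon> * \<phi>)\<close> absorbs
        \<open>c\<close>, since \<open>1 / c \<le> M\<close>.\<close>
      have "exp (- (\<epsilon> / 4) * \<phi>) * (1 / c) \<le> exp (- (\<epsilon> / 4) * \<phi>) * M"
        using M(2) by (intro mult_left_mono) auto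
      then have "exp (- (\<epsilon> / 4) * \<phi>) / c \<le> 1"
        using finite_case(6)[OF \<phi>] by simp
      then have "exp (- (\<epsilon> / 4) * \<phi>) \<le> c"
        using c(1) by (simp only: pos_divide_le_eq mult_1)
      moreover have "exp (- \<epsilon> * \<phi>) \<le> exp (- (\<epsilon> / 4) * \<phi>)"
        using finite_case(5)[OF \<phi>] assms by simp
      ultimately have "exp (- \<epsilon> * \<phi>) \<le> c" by linarith
      then have "exp (- \<epsilon> * \<phi>) * exp (- \<phi>) \<le> c * exp (- \<phi>)"
        by (intro mult_right_mono) auto
      also have "exp (- \<epsilon> * \<phi>) * exp (- \<phi>) = exp (- ((1 + \<epsilon>) * \<phi>))"
        by (simp add: exp_add[symmetric] algebra_simps)
      finally have "exp (- ((1 + \<epsilon>) * \<phi>)) \<le> ?P"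
        using finite_case(4)[OF \<phi>] by linarith
      then show ?thesis using neg_log_le \<phi> by simp
    qed

    have rest: "?R \<le> \<epsilon> * ?P"
    proof -
      have "?small = ?core - (?core - ?small)" by (auto simp: small_core_family_def)
      then have "?R \<le> ?Q + (\<Sum>I\<in>?core - ?small. p ^ card I)"
        using prob_Y_union_bound[of "?core - ?small" ?core "\<lambda>y. X y \<ge> ?t"] core_fin core_sub
        by (metis Diff_subset finite_Diff)
      also have "\<dots> \<le> \<epsilon> * ?P"
      proof (cases "Phi N p X (\<delta> + \<epsilon>) = \<infinity>")
        case True
        \<comment> \<open>With an infinite bound every core is small.\<close>
        then have "?core - ?small = {}" using assms by (auto simp: small_core_family_def)
        then have "(\<Sum>I\<in>?core - ?small. p ^ card I) = 0" by (simp only: sum.empty)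
        then show ?thesis using Q_infinite[OF True] assms by simp
      next
        case False
        then obtain \<phi> where \<phi>: "Phi N p X (\<delta> + \<epsilon>) = ereal \<phi>"
          using Phi_attained by blast
        note fin = finite_case[OF \<phi>]
        have "(1 + \<epsilon>) * \<phi> \<le> real (card I) * ?L" if "I \<in> ?core - ?small" for I
        proof -
          have "\<not> ereal (real (card I) * ?L) \<le> ereal (1 + \<epsilon>) * ereal \<phi>"
            using that core_sub[of I] neg_log_prob_Y_prod[of I]
            by (auto simp: small_core_family_def \<phi>)
          then show ?thesis by simp
        qed
        then have "(\<Sum>I\<in>?core - ?small. p ^ card I) \<le>
            C * exp (- (1 - \<epsilon> / 2) * ((1 + \<epsilon>) * \<phi>))"
          unfolding C_def using assms p stable core_sub
          by (intro stable_family_sum_le[where H = ?core and N = N]) auto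
        also have "\<dots> \<le> C * exp (- (1 + \<epsilon> / 4) * \<phi>)"
        proof -
          \<comment> \<open>As \<open>\<epsilon> < 1 / 2\<close>, the gain
            \<open>1 + \<epsilon>\<close> from not being small outweighs the entropy loss
            \<open>1 - \<epsilon> / 2\<close>, leaving an exponent strictly beyond
            \<open>\<phi>\<close>.\<close>
          have "\<epsilon> * \<epsilon> \<le> \<epsilon> * (1 / 2)" using assms by (intro mult_left_mono) auto
          moreover have "(1 - \<epsilon> / 2) * (1 + \<epsilon>) = 1 + \<epsilon> / 2 - \<epsilon> * \<epsilon> / 2"
            by (simp add: field_simps)
          ultimately have "1 + \<epsilon> / 4 \<le> (1 - \<epsilon> / 2) * (1 + \<epsilon>)" by linarith
          then have "(1 + \<epsilon> / 4) * \<phi> \<le> (1 - \<epsilon> / 2) * (1 + \<epsilon>) * \<phi>"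
            using fin(5) by (intro mult_right_mono) auto
          then have "- (1 - \<epsilon> / 2) * ((1 + \<epsilon>) * \<phi>) \<le> - (1 + \<epsilon> / 4) * \<phi>"
            by (simp only: mult_minus_left neg_le_iff_le mult.assoc)
          then show ?thesis using C by (intro mult_left_mono) (simp_all only: exp_le_cancel_iff)
        qed
        finally have "?Q + (\<Sum>I\<in>?core - ?small. p ^ card I) \<le>
            exp (- (1 + \<epsilon> / 4) * \<phi>) + C * exp (- (1 + \<epsilon> / 4) * \<phi>)"
        proof (rule add_mono[rotated])
          have "(1 + \<epsilon> / 4) * \<phi> \<le> 2 * \<phi>" using fin(5) assms by (intro mult_right_mono) auto
          then have "exp (- 2 * \<phi>) \<le> exp (- (1 + \<epsilon> / 4) * \<phi>)"
            unfolding exp_le_cancel_iff by linarith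
          then show "?Q \<le> exp (- (1 + \<epsilon> / 4) * \<phi>)" using fin(3) by linarith
        qed
        also have "\<dots> = (1 + C) * exp (- (1 + \<epsilon> / 4) * \<phi>)" by (simp add: algebra_simps)
        \<comment> \<open>Exact by the choice of \<open>M\<close>; the first factor is
          \<open>\<epsilon>\<close> times the lower bound on \<open>?P\<close>.\<close>
        also have "\<dots> = \<epsilon> * (c * exp (- \<phi>)) * (exp (- (\<epsilon> / 4) * \<phi>) * M)"
        proof -
          have "exp (- (1 + \<epsilon> / 4) * \<phi>) = exp (- \<phi>) * exp (- (\<epsilon> / 4) * \<phi>)"
            by (simp add: exp_add[symmetric] algebra_simps)
          then show ?thesis using c assms by (simp add: M_def)
        qed
        also have "\<dots> \<le> \<epsilon> * (c * exp (- \<phi>)) * 1"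
          using fin(6) c assms by (intro mult_left_mono) auto
        also have "\<dots> \<le> \<epsilon> * ?P" using fin(4) assms by simp
        finally show ?thesis .
      qed
      finally show ?thesis .
    qed
    show "ereal (1 - \<epsilon>) * Phi N p X (\<delta> - \<epsilon>)
         \<le> neg_log (prob_Y N p {y. X y \<ge> (1 + \<delta>) * expect_Y N p X}) \<and>
       neg_log (prob_Y N p {y. X y \<ge> (1 + \<delta>) * expect_Y N p X})
         \<le> ereal (1 + \<epsilon>) * Phi N p X (\<delta> + \<epsilon>) \<and>
       prob_Y N p {y. X y \<ge> (1 + \<delta>) * expect_Y N p X \<and>
                      (\<forall>I \<in> ?small. Y_prod I y = 0)}
         \<le> \<epsilon> * prob_Y N p {y. X y \<ge> (1 + \<delta>) * expect_Y N p X}"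
      unfolding expect_eq_F by (intro conjI lower upper rest)
  qed
qed

end
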